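(* Let $T=T(l)$ be a finite labeled tree with $|V(T)|\ge 2$, let the labeling $l\colon V(T)\to\mathbb{R}^+$ be non-degenerate, let $w\colon E(T)\to\mathbb{R}^+$ be defined by \[ w(\{u,v\}):=\max\{l(u),l(v)\} \] for each $\{u,v\}\in E(T)$, and let $d_l$ be generated by $T(l)$. Then the following statements are equivalent: (i) $(V(T),d_l)\in\mathbf{GH}$. (ii) The mapping $w\colon E(T)\to\mathbb{R}^+$ is injective. (iii) The distance set $D(V(T))$ of $(V(T),d_l)$ satisfies the equality $|D(V(T))|=|E(T)|+1$. (iv) The distance set $D(V(T))$ of $(V(T),d_l)$ satisfies the equality $2|D(V(T))|=2+\sum_{v\in V(T)}\delta_T(v)$.
   Context: $\mathbb{R}^+:=[0,\infty)$. A graph $G$ is a pair $(V,E)$ with $V=V(G)$ a non-empty set and $E=E(G)$ a (possibly empty) set of unordered pairs of distinct elements of $V$. A path is a graph with vertex set $\{x_0,\dots,x_k\}$, all $x_i$ distinct, $k\ge 1$, and edge set $\{\{x_0,x_1\},\dots,\{x_{k-1},x_k\}\}$; it joins $x_0$ and $x_k$. A tree is a connected graph without cycles. The degree $\delta_T(v)$ of a vertex $v$ of $T$ is the number of vertices adjacent to $v$ in $T$. A labeled tree $T(l)$ is a tree $T$ together with a labeling $l\colon V(T)\to\mathbb{R}^+$. The labeling $l$ is non-degenerate if $\max\{l(u),l(v)\}>0$ for each edge $\{u,v\}\in E(T)$. The mapping $d_l\colon V(T)\times V(T)\to\mathbb{R}^+$ generated by $T(l)$ is defined by $d_l(x,x):=0$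 and, for $x\neq y$, $d_l(x,y):=\max_{v\in V(P)}l(v)$, where $P$ is the unique path joining $x$ and $y$ in $T$. (For a non-degenerate labeling of a tree, $d_l$ is an ultrametric.) An ultrametric on a non-empty set $X$ is a function $d\colon X\times X\to\mathbb{R}^+$ with $d(x,y)=d(y,x)$, $d(x,y)=0\iff x=y$, and $d(x,y)\le\max\{d(x,z),d(z,y)\}$ for all $x,y,z\in X$. The distance set of $(X,d)$ is $D(X):=\{d(x,y):x,y\in X\}$ (it contains $0$). $\mathbf{GH}$ denotes the class of all finite ultrametric spaces $(X,d)$ with $|D(X)|=|X|$. *)

theory Defs
  imports Complex_Main
begin

section \<open>Graphs and trees\<close>

text \<open>A graph is given by its vertex set \<open>V\<close> and its set \<open>E\<close> of two-element subsets of \<open>V\<close>.\<close>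

definition simple_graph :: "'a set \<Rightarrow> 'a set set \<Rightarrow> bool" where
  "simple_graph V E \<longleftrightarrow> V \<noteq> {} \<and> (\<forall>e\<in>E. \<exists>u\<in>V. \<exists>v\<in>V. u \<noteq> v \<and> e = {u, v})"

definition degree :: "'a set \<Rightarrow> 'a set set \<Rightarrow> 'a \<Rightarrow> nat" where
  "degree V E v = card {u \<in> V. {u, v} \<in> E}"

text \<open>A path with vertices \<open>x\<^sub>0, \<dots>, x\<^sub>k\<close> (\<open>k \<ge> 1\<close>) is represented by the list
  \<open>[x\<^sub>0, \<dots>, x\<^sub>k]\<close>. As a subgraph, a path joining \<open>x\<close> and \<open>y\<close> corresponds to exactly one such
  list starting at \<open>x\<close> and ending at \<open>y\<close>.\<close>

definition path_edges :: "'a list \<Rightarrow> 'a set set" where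
  "path_edges xs = {{xs ! i, xs ! Suc i} |i. Suc i < length xs}"

definition is_path :: "'a set \<Rightarrow> 'a set set \<Rightarrow> 'a list \<Rightarrow> bool" where
  "is_path V E xs \<longleftrightarrow>
     length xs \<ge> 2 \<and> distinct xs \<and> set xs \<subseteq> V \<and> path_edges xs \<subseteq> E"

definition path_joins :: "'a set \<Rightarrow> 'a set set \<Rightarrow> 'a \<Rightarrow> 'a list \<Rightarrow> 'a \<Rightarrow> bool" where
  "path_joins V E x xs y \<longleftrightarrow> is_path V E xs \<and> hd xs = x \<and> last xs = y"

text \<open>A cycle closes a path on at least three vertices by an edge between its ends.\<close>

definition is_cycle :: "'a set \<Rightarrow> 'a set set \<Rightarrow> 'a list \<Rightarrow> bool" where
  "is_cycle V E xs \<longleftrightarrow> length xs \<ge> 3 \<and> is_path V E xs \<and> {last xs, hd xs} \<in> E"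

definition connected_graph :: "'a set \<Rightarrow> 'a set set \<Rightarrow> bool" where
  "connected_graph V E \<longleftrightarrow> (\<forall>x\<in>V. \<forall>y\<in>V. x \<noteq> y \<longrightarrow> (\<exists>xs. path_joins V E x xs y))"

definition tree :: "'a set \<Rightarrow> 'a set set \<Rightarrow> bool" where
  "tree V E \<longleftrightarrow> simple_graph V E \<and> connected_graph V E \<and> \<not> (\<exists>xs. is_cycle V E xs)"

section \<open>Labeled trees\<close>

definition labeling :: "'a set \<Rightarrow> ('a \<Rightarrow> real) \<Rightarrow> bool" where
  "labeling V l \<longleftrightarrow> (\<forall>v\<in>V. 0 \<le> l v)"

definition nondegenerate :: "'a set set \<Rightarrow> ('a \<Rightarrow> real) \<Rightarrow> bool" where
  "nondegenerate E l \<longleftrightarrow> (\<forall>u v. {u, v} \<in> E \<longrightarrow> max (l u) (l v) > 0)"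

text \<open>The definite description is meaningful when \<open>(V, E)\<close> is a tree and \<open>x \<noteq> y\<close> are vertices;
  only values on \<open>V \<times> V\<close> matter.\<close>

definition label_dist :: "'a set \<Rightarrow> 'a set set \<Rightarrow> ('a \<Rightarrow> real) \<Rightarrow> 'a \<Rightarrow> 'a \<Rightarrow> real" where
  "label_dist V E l x y =
     (if x = y then 0 else Max (l ` set (THE xs. path_joins V E x xs y)))"

section \<open>Ultrametric spaces\<close>

definition ultrametric_on :: "'a set \<Rightarrow> ('a \<Rightarrow> 'a \<Rightarrow> real) \<Rightarrow> bool" where
  "ultrametric_on X d \<longleftrightarrow> X \<noteq> {} \<and>
     (\<forall>x\<in>X. \<forall>y\<in>X. 0 \<le> d x y) \<and>
     (\<forall>x\<in>X. \<forall>y\<in>X. d x y = d y x) \<and>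
     (\<forall>x\<in>X. \<forall>y\<in>X. d x y = 0 \<longleftrightarrow> x = y) \<and>
     (\<forall>x\<in>X. \<forall>y\<in>X. \<forall>z\<in>X. d x y \<le> max (d x z) (d z y))"

definition distance_set :: "'a set \<Rightarrow> ('a \<Rightarrow> 'a \<Rightarrow> real) \<Rightarrow> real set" where
  "distance_set X d = {d x y |x y. x \<in> X \<and> y \<in> X}"

definition GH :: "('a set \<times> ('a \<Rightarrow> 'a \<Rightarrow> real)) set" where
  "GH = {(X, d). finite X \<and> ultrametric_on X d \<and> card (distance_set X d) = card X}"

end

theory Submission
  imports Defs
begin

text \<open>In a tree every edge is a bridge, so paths are unique and \<open>d\<^sub>l x y \<le> r\<close> holds exactly when
  \<open>x\<close> and \<open>y\<close> are connected by edges both of whose ends have labels at most \<open>r\<close>. This makes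
  \<open>d\<^sub>l\<close> an ultrametric, and it shows that every nonzero distance is already the distance of two
  adjacent vertices. Hence the distance set is \<open>w(E)\<close> together with \<open>0\<close>, where \<open>0 \<notin> w(E)\<close> by
  non-degeneracy. Since \<open>|V| = |E| + 1\<close> and the degrees sum to \<open>2|E|\<close>, each of the conditions
  says that \<open>|w(E)| = |E|\<close>.\<close>

section \<open>Paths and reachability\<close>

text \<open>As a relation, adjacency admits \<open>rtrancl\<close>, where walks concatenate freely
  without any care for repeated vertices.\<close>

definition adj :: "'a set set \<Rightarrow> ('a \<times> 'a) set" where
  "adj E = {(u, v). {u, v} \<in> E}"

text \<open>Unlike \<open>path_joins\<close>, this admits the trivial list \<open>[x]\<close> joining \<open>x\<close> to itself.\<close>

definition joins :: "'a set set \<Rightarrow> 'a \<Rightarrow> 'a list \<Rightarrow> 'a \<Rightarrow> bool" where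
  "joins E x xs y \<longleftrightarrow> xs \<noteq> [] \<and> distinct xs \<and> successively (\<lambda>u v. {u, v} \<in> E) xs
     \<and> hd xs = x \<and> last xs = y"

lemma sym_adj: "sym (adj E)"
  by (auto simp: adj_def sym_def insert_commute)

lemma rtrancl_adj_sym: "(x, y) \<in> (adj E)\<^sup>* \<Longrightarrow> (y, x) \<in> (adj E)\<^sup>*"
  by (meson sym_adj sym_rtrancl symD)

lemma joins_Cons:
  "joins E x (a # xs) y \<longleftrightarrow>
     a = x \<and> (if xs = [] then x = y else x \<notin> set xs \<and> {x, hd xs} \<in> E \<and> joins E (hd xs) xs y)"
  by (cases xs) (auto simp: joins_def)

lemma joins_mono: "joins F x xs y \<Longrightarrow> F \<subseteq> E \<Longrightarrow> joins E x xs y"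
  unfolding joins_def by (auto elim: successively_mono)

lemma joins_nonemptyD: "joins E x xs y \<Longrightarrow> xs \<noteq> [] \<and> hd xs = x"
  by (simp add: joins_def)

lemma joins_last_in_set: "joins E x xs y \<Longrightarrow> y \<in> set xs"
  by (auto simp: joins_def)

lemma joins_refl_iff: "joins E x xs x \<longleftrightarrow> xs = [x]"
proof (cases xs)
  case (Cons a as)
  then show ?thesis
    by (auto simp: joins_Cons joins_def)
qed (simp add: joins_def)

lemma joins_suffix: "joins E x (as @ z # bs) y \<Longrightarrow> joins E z (z # bs) y"
  by (auto simp: joins_def successively_append_iff)

lemma joins_imp_rtrancl: "joins E x xs y \<Longrightarrow> (x, y) \<in> (adj E)\<^sup>*"
proof (induction xs arbitrary: x)
  case (Cons a xs)
  then show ?case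
    by (auto simp: joins_Cons adj_def split: if_splits intro: converse_rtrancl_into_rtrancl)
qed (simp add: joins_def)

text \<open>A walk shrinks to a path: if the vertex to be prepended already occurs, the suffix
  starting there is kept instead.\<close>

lemma rtrancl_imp_joins:
  assumes "(x, y) \<in> (adj E)\<^sup>*"
  shows "\<exists>xs. joins E x xs y"
  using assms
proof (induction rule: converse_rtrancl_induct)
  case base
  show ?case by (auto simp: joins_refl_iff)
next
  case (step x z)
  then obtain xs where xs: "joins E z xs y" by blast
  show ?case
  proof (cases "x \<in> set xs")
    case True
    then show ?thesis
      using xs by (metis joins_suffix split_list)
  next
    case False
    then have "joins E x (x # xs) y"
      using step(1) xs by (auto simp: joins_Cons adj_def dest: joins_nonemptyD)
    then show ?thesis by blast
  qed
qed

text \<open>Distinct ends exclude the trivial list, so each listed vertex is an end of a listed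
  edge. A bound on the labels in all edges of \<open>E\<close> thus reaches every vertex of the
  path.\<close>

lemma joins_vertices_in_edges:
  assumes "joins E x xs y" and "x \<noteq> y"
  shows "set xs \<subseteq> \<Union>E"
  using assms
proof (induction xs arbitrary: x)
  case (Cons a xs)
  show ?case
  proof (cases "hd xs = y")
    case True
    with Cons.prems have "xs = [y]"
      by (auto simp: joins_Cons joins_refl_iff split: if_splits)
    with Cons.prems show ?thesis
      by (auto simp: joins_Cons)
  next
    case False
    with Cons show ?thesis
      by (auto simp: joins_Cons split: if_splits)
  qed
qed (simp add: joins_def)

lemma path_edges_subset_iff:
  "path_edges xs \<subseteq> E \<longleftrightarrow> successively (\<lambda>u v. {u, v} \<in> E) xs"
  by (auto simp: path_edges_def successively_conv_nth)

lemma path_joins_iff: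
  assumes "simple_graph V E" and "x \<noteq> y"
  shows "path_joins V E x xs y \<longleftrightarrow> joins E x xs y"
proof
  assume "path_joins V E x xs y"
  then show "joins E x xs y"
    by (auto simp: path_joins_def is_path_def joins_def path_edges_subset_iff)
next
  assume j: "joins E x xs y"
  have "set xs \<subseteq> V"
    using joins_vertices_in_edges[OF j assms(2)] assms(1) by (fastforce simp: simple_graph_def)
  moreover have "length xs \<ge> 2"
    using j assms(2) by (cases xs; cases "tl xs") (auto simp: joins_def)
  ultimately show "path_joins V E x xs y"
    using j by (auto simp: path_joins_def is_path_def joins_def path_edges_subset_iff)
qed

text \<open>A path that misses \<open>z\<close> uses no edge at \<open>z\<close>, whatever the other
  end \<open>z'\<close> is.\<close>

lemma joins_avoiding:
  assumes "joins E x xs y" and "z \<notin> set xs"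
  shows "joins (E - {{z, z'}}) x xs y"
proof -
  have "successively (\<lambda>u v. {u, v} \<in> E - {{z, z'}}) xs"
    using assms by (auto simp: joins_def doubleton_eq_iff elim!: successively_mono)
  with assms(1) show ?thesis by (simp add: joins_def)
qed

section \<open>Trees\<close>

lemma simple_graph_edgeD:
  assumes "simple_graph V E" and "{u, v} \<in> E"
  shows "u \<in> V" "v \<in> V" "u \<noteq> v"
  using assms by (fastforce simp: simple_graph_def doubleton_eq_iff)+

lemma simple_graph_edgeE:
  assumes "simple_graph V E" and "e \<in> E"
  obtains u v where "e = {u, v}" "u \<in> V" "v \<in> V" "u \<noteq> v"
  using assms unfolding simple_graph_def by blast

lemma simple_graph_finite_edges:
  assumes "simple_graph V E" and "finite V"
  shows "finite E"
proof (rule finite_subset)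
  show "E \<subseteq> Pow V"
    using assms(1) by (auto simp: simple_graph_def)
qed (use assms in simp)

text \<open>Otherwise a path between the ends that avoids the edge would be closed to a cycle by
  that edge.\<close>

lemma tree_edge_bridge:
  assumes "tree V E" and "{u, v} \<in> E"
  shows "(u, v) \<notin> (adj (E - {{u, v}}))\<^sup>*"
proof
  assume "(u, v) \<in> (adj (E - {{u, v}}))\<^sup>*"
  then obtain xs where xs: "joins (E - {{u, v}}) u xs v"
    using rtrancl_imp_joins by metis
  have sg: "simple_graph V E" and "u \<noteq> v"
    using assms simple_graph_edgeD[of V E] by (auto simp: tree_def)
  then have p: "path_joins V E u xs v"
    using xs path_joins_iff joins_mono by (metis Diff_subset)
  \<comment> \<open>A cycle needs three vertices; a path on two would consist of the deleted edge
    itself.\<close>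
  have "length xs \<noteq> 2"
  proof
    assume "length xs = 2"
    then have "xs = [hd xs, last xs]"
      by (cases xs; cases "tl xs") auto
    with xs show False
      by (metis (no_types, lifting) DiffD2 joins_def singletonI successively.simps(3))
  qed
  with p have "is_cycle V E xs"
    using assms(2) by (auto simp: is_cycle_def path_joins_def is_path_def insert_commute)
  with assms(1) show False
    by (auto simp: tree_def)
qed

text \<open>At the first point where two paths diverge, the next edge of one is bypassed by the
  other path followed by the reversed rest of the first, so it is no bridge.\<close>

lemma tree_joins_unique:
  assumes "tree V E" and "joins E x xs y" and "joins E x ys y"
  shows "xs = ys"
  using assms(2,3)
proof (induction xs arbitrary: x ys)
  case (Cons a xs)
  show ?case
  proof (cases "x = y")
    case True
    with Cons.prems show ?thesis
      by (simp add: joins_refl_iff)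
  next
    case False
    have xs: "a = x" "x \<notin> set xs" "{x, hd xs} \<in> E" "joins E (hd xs) xs y"
      using Cons.prems(1) False by (auto simp: joins_Cons split: if_splits)
    obtain zs where ys: "ys = x # zs"
      using Cons.prems(2) by (cases ys) (auto simp: joins_def)
    have zs: "x \<notin> set zs" "{x, hd zs} \<in> E" "joins E (hd zs) zs y"
      using Cons.prems(2) False by (auto simp: ys joins_Cons split: if_splits)
    have "hd xs = hd zs"
    proof (rule ccontr)
      assume ne: "hd xs \<noteq> hd zs"
      let ?F = "E - {{x, hd xs}}"
      have "(x, hd zs) \<in> adj ?F"
        using zs(2) ne by (auto simp: adj_def doubleton_eq_iff)
      also have "(hd zs, y) \<in> (adj ?F)\<^sup>*"
        using joins_imp_rtrancl[OF joins_avoiding[OF zs(3,1)]] .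
      also have "(y, hd xs) \<in> (adj ?F)\<^sup>*"
        using rtrancl_adj_sym[OF joins_imp_rtrancl[OF joins_avoiding[OF xs(4,2)]]] .
      finally have "(x, hd xs) \<in> (adj ?F)\<^sup>*"
        by simp
      with tree_edge_bridge[OF assms(1) xs(3)] show False by simp
    qed
    then show ?thesis
      using Cons.IH xs zs ys by metis
  qed
qed (simp add: joins_def)

lemma tree_joins_ex:
  assumes "tree V E" and "x \<in> V" and "y \<in> V"
  shows "\<exists>xs. joins E x xs y"
proof (cases "x = y")
  case False
  with assms show ?thesis
    by (auto simp: tree_def connected_graph_def path_joins_iff)
qed (auto simp: joins_refl_iff)

lemma tree_joins_ex1:
  assumes "tree V E" and "x \<in> V" and "y \<in> V"
  shows "\<exists>!xs. joins E x xs y"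
  using tree_joins_ex[OF assms] tree_joins_unique[OF assms(1)] by blast

text \<open>Orienting the tree towards a root \<open>r\<close>, each vertex other than \<open>r\<close> owns the first edge of
  its path to \<open>r\<close>.\<close>

lemma tree_card_vertices:
  assumes t: "tree V E" and fin: "finite V"
  shows "card V = card E + 1"
proof -
  have sg: "simple_graph V E" and "V \<noteq> {}"
    using t by (auto simp: tree_def simple_graph_def)
  then obtain r where r: "r \<in> V" by blast
  define P where "P v = (THE xs. joins E v xs r)" for v
  have P: "joins E v (P v) r" if "v \<in> V" for v
    unfolding P_def using theI'[OF tree_joins_ex1[OF t that r]] .
  have P_eq: "P v = xs" if "v \<in> V" "joins E v xs r" for v xs
    using tree_joins_unique[OF t P[OF that(1)] that(2)] .
  define f where "f v = {v, hd (tl (P v))}" for v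
  \<comment> \<open>The witness \<open>p\<close> is the parent of \<open>v\<close>, the next vertex
    on its path to the root.\<close>
  have P_step: "\<exists>p. P v = v # P p \<and> v \<notin> set (P p) \<and> f v = {v, p} \<and> {v, p} \<in> E \<and> p \<in> V"
    if v: "v \<in> V - {r}" for v
  proof -
    obtain xs where xs: "P v = v # xs"
      using P[of v] v by (cases "P v") (auto simp: joins_def)
    have j: "v \<notin> set xs" "{v, hd xs} \<in> E" "joins E (hd xs) xs r"
      using P[of v] v by (auto simp: xs joins_Cons split: if_splits)
    have "hd xs \<in> V"
      using simple_graph_edgeD[OF sg j(2)] by simp
    moreover from this have "P (hd xs) = xs"
      using P_eq j(3) by blast
    ultimately show ?thesis
      using xs j by (intro exI[of _ "hd xs"]) (simp add: f_def)
  qed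
  have "bij_betw f (V - {r}) E"
    unfolding bij_betw_def
  proof
    show "inj_on f (V - {r})"
    proof (rule inj_onI, rule ccontr)
      \<comment> \<open>Two owners of one edge would be each other's parent, so \<open>P v\<close>
        would pass through \<open>u\<close>, which \<open>P u = u # P v\<close> forbids.\<close>
      fix u v assume uv: "u \<in> V - {r}" "v \<in> V - {r}" "f u = f v" "u \<noteq> v"
      obtain p where p: "P u = u # P p" "u \<notin> set (P p)" "f u = {u, p}"
        using P_step[OF uv(1)] by blast
      obtain q where q: "P v = v # P q" "v \<notin> set (P q)" "f v = {v, q}"
        using P_step[OF uv(2)] by blast
      have "p = v" "q = u"
        using uv(3,4) p(3) q(3) by (auto simp: doubleton_eq_iff)
      with p q show False by auto
    qed
    show "f ` (V - {r}) = E"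
    proof
      show "f ` (V - {r}) \<subseteq> E"
        using P_step by fastforce
      show "E \<subseteq> f ` (V - {r})"
      proof
        fix e assume e: "e \<in> E"
        obtain u v where uv: "e = {u, v}" "u \<in> V" "v \<in> V" "u \<noteq> v"
          using simple_graph_edgeE[OF sg e] .
        \<comment> \<open>An edge is owned by the end that is missing from the other end's path to
          the root, since prepending it gives its own path.\<close>
        have child: "{a, b} \<in> f ` (V - {r})"
          if ab: "{a, b} \<in> E" "a \<in> V" "b \<in> V" "a \<notin> set (P b)" for a b
        proof -
          have "b = hd (P b)" "P b \<noteq> []"
            using P[OF ab(3)] by (auto simp: joins_def)
          then have "joins E a (a # P b) r"
            using ab P[OF ab(3)] by (simp add: joins_Cons)
          then have "f a = {a, b}"
            using P_eq ab(2) \<open>b = hd (P b)\<close> by (simp add: f_def)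
          moreover have "a \<noteq> r"
            using ab(4) joins_last_in_set[OF P[OF ab(3)]] by blast
          ultimately show ?thesis
            using ab(2) by blast
        qed
        show "e \<in> f ` (V - {r})"
        proof (cases "u \<in> set (P v)")
          case True
          then obtain as bs where s: "P v = as @ u # bs"
            by (meson split_list)
          \<comment> \<open>Here \<open>v\<close> is the owner: the path from \<open>u\<close> is a
            proper suffix of the one from \<open>v\<close>, hence misses \<open>v\<close>.\<close>
          then have "P u = u # bs"
            using P_eq[OF uv(2)] joins_suffix P[OF uv(3)] by metis
          moreover have "as \<noteq> []" "hd as = v"
            using P[OF uv(3)] s uv(4) by (cases as; auto simp: joins_def)+
          ultimately have "v \<notin> set (P u)"
            using P[OF uv(3)] s uv(4) hd_in_set[of as] by (auto simp: joins_def)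
          then show ?thesis
            using child[of v u] uv e by (simp add: insert_commute)
        next
          case False
          then show ?thesis
            using child[of u v] uv e by simp
        qed
      qed
    qed
  qed
  then have "card (V - {r}) = card E"
    by (rule bij_betw_same_card)
  then show ?thesis
    by (simp add: card.remove[OF fin r])
qed

text \<open>Double counting of incidences, after neighbours of \<open>v\<close> are exchanged for
  edges at \<open>v\<close>.\<close>

lemma sum_degree:
  assumes sg: "simple_graph V E" and fin: "finite V"
  shows "(\<Sum>v\<in>V. degree V E v) = 2 * card E"
proof -
  have finE: "finite E"
    using simple_graph_finite_edges[OF assms] .
  have deg: "degree V E v = card {e \<in> E. v \<in> e}" for v
  proof -
    have "bij_betw (\<lambda>u. {u, v}) {u \<in> V. {u, v} \<in> E} {e \<in> E. v \<in> e}"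
      unfolding bij_betw_def
    proof
      show "inj_on (\<lambda>u. {u, v}) {u \<in> V. {u, v} \<in> E}"
        by (auto simp: inj_on_def doubleton_eq_iff)
      show "(\<lambda>u. {u, v}) ` {u \<in> V. {u, v} \<in> E} = {e \<in> E. v \<in> e}"
        using sg by (fastforce simp: simple_graph_def insert_commute image_iff)
    qed
    then show ?thesis
      unfolding degree_def by (rule bij_betw_same_card)
  qed
  have "(\<Sum>v\<in>V. degree V E v) = (\<Sum>v\<in>V. card {e \<in> E. v \<in> e})"
    by (simp add: deg)
  also have "\<dots> = 2 * card E"
  proof (rule sum_multicount[OF fin finE], rule ballI)
    fix e assume "e \<in> E"
    then obtain u v where "e = {u, v}" "u \<in> V" "v \<in> V" "u \<noteq> v"
      using simple_graph_edgeE[OF sg] by metis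
    then have "{i \<in> V. i \<in> e} = {u, v}" by auto
    then show "card {i \<in> V. i \<in> e} = 2"
      using \<open>u \<noteq> v\<close> by simp
  qed
  finally show ?thesis .
qed

section \<open>The distance generated by a labeling\<close>

text \<open>Uniqueness of paths resolves the definite description, so any path at hand computes the
  distance.\<close>

lemma label_dist_joins:
  assumes "tree V E" and "x \<noteq> y" and "joins E x xs y"
  shows "label_dist V E l x y = Max (l ` set xs)"
proof -
  have "simple_graph V E"
    using assms(1) by (simp add: tree_def)
  then have "(THE ys. path_joins V E x ys y) = xs"
    using assms by (intro the_equality) (auto simp: path_joins_iff tree_joins_unique)
  with assms(2) show ?thesis
    by (simp add: label_dist_def)
qed

lemma label_dist_edge:
  assumes "tree V E" and "{u, v} \<in> E"
  shows "label_dist V E l u v = max (l u) (l v)"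
proof -
  have "u \<noteq> v"
    using assms simple_graph_edgeD(3)[of V E u v] by (simp add: tree_def)
  then show ?thesis
    using label_dist_joins[of V E u v "[u, v]" l] assms by (simp add: joins_def)
qed

text \<open>Trades a maximum over a path for reachability in a threshold graph, where symmetry and
  transitivity are free. The bound \<open>0 \<le> r\<close> accounts for the distance
  \<open>0\<close> on the diagonal.\<close>

lemma label_dist_le_iff:
  assumes t: "tree V E" and xy: "x \<in> V" "y \<in> V" and r: "0 \<le> r"
  shows "label_dist V E l x y \<le> r \<longleftrightarrow> (x, y) \<in> (adj {e \<in> E. \<forall>v\<in>e. l v \<le> r})\<^sup>*"
    (is "_ \<longleftrightarrow> _ \<in> (adj ?F)\<^sup>*")
proof (cases "x = y")
  case True
  with r show ?thesis by (simp add: label_dist_def)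
next
  case False
  obtain xs where xs: "joins E x xs y"
    using tree_joins_ex[OF t xy] by blast
  have d: "label_dist V E l x y \<le> r \<longleftrightarrow> (\<forall>v\<in>set xs. l v \<le> r)"
    using xs by (auto simp: label_dist_joins[OF t False xs] joins_def)
  show ?thesis
  proof
    assume "label_dist V E l x y \<le> r"
    then have "joins ?F x xs y"
      using xs d by (auto simp: joins_def elim!: successively_mono)
    then show "(x, y) \<in> (adj ?F)\<^sup>*"
      by (rule joins_imp_rtrancl)
  next
    assume "(x, y) \<in> (adj ?F)\<^sup>*"
    from rtrancl_imp_joins[OF this] obtain ys where ys: "joins ?F x ys y" ..
    then have "joins E x ys y"
      by (rule joins_mono) auto
    \<comment> \<open>A path in the threshold graph is also a path of the tree, hence the one that
      defines the distance.\<close>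
    then have "ys = xs"
      using tree_joins_unique[OF t _ xs] by blast
    then show "label_dist V E l x y \<le> r"
      using joins_vertices_in_edges[OF ys False] d by blast
  qed
qed

text \<open>The first edge of the path already contains a vertex with positive label.\<close>

lemma label_dist_pos:
  assumes t: "tree V E" and xy: "x \<in> V" "y \<in> V" "x \<noteq> y" and nd: "nondegenerate E l"
  shows "0 < label_dist V E l x y"
proof -
  obtain xs where xs: "joins E x xs y"
    using tree_joins_ex[OF t xy(1,2)] by blast
  then obtain zs where zs: "xs = x # zs"
    by (cases xs) (auto simp: joins_def)
  have e: "{x, hd zs} \<in> E" "zs \<noteq> []"
    using xs xy(3) by (auto simp: zs joins_Cons split: if_splits)
  have "0 < max (l x) (l (hd zs))"
    using nd e by (auto simp: nondegenerate_def)
  also have "\<dots> \<le> Max (l ` set xs)"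
    using e(2) by (intro max.boundedI Max_ge) (auto simp: zs)
  finally show ?thesis
    by (simp add: label_dist_joins[OF t xy(3) xs])
qed

lemma label_dist_nonneg:
  assumes "tree V E" and "x \<in> V" "y \<in> V" and "nondegenerate E l"
  shows "0 \<le> label_dist V E l x y"
  using label_dist_pos[OF assms(1-3) _ assms(4)] by (cases "x = y") (auto simp: label_dist_def)

lemma label_dist_ultrametric:
  assumes t: "tree V E" and nd: "nondegenerate E l"
  shows "ultrametric_on V (label_dist V E l)"
proof -
  let ?d = "label_dist V E l"
  have nonneg: "0 \<le> ?d x y" if "x \<in> V" "y \<in> V" for x y
    using label_dist_nonneg[OF t that nd] .
  have "?d x y \<le> ?d y x" if xy: "x \<in> V" "y \<in> V" for x y
  proof -
    have r: "0 \<le> ?d y x"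
      using nonneg xy by simp
    have "(y, x) \<in> (adj {e \<in> E. \<forall>v\<in>e. l v \<le> ?d y x})\<^sup>*"
      using label_dist_le_iff[OF t xy(2,1) r, of l] by simp
    then show ?thesis
      using label_dist_le_iff[OF t xy r, of l] rtrancl_adj_sym by simp
  qed
  then have "?d x y = ?d y x" if "x \<in> V" "y \<in> V" for x y
    using that by (simp add: antisym)
  moreover have "?d x y \<le> max (?d x z) (?d z y)" if "x \<in> V" "y \<in> V" "z \<in> V" for x y z
  proof -
    \<comment> \<open>At this threshold \<open>z\<close> is reachable from \<open>x\<close> and
      \<open>y\<close> from \<open>z\<close>, so transitivity yields the strong triangle
      inequality.\<close>
    let ?r = "max (?d x z) (?d z y)"
    have r: "0 \<le> ?r"
      using nonneg that by (simp add: le_max_iff_disj)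
    show ?thesis
      using label_dist_le_iff[OF t that(1,2) r] label_dist_le_iff[OF t that(1,3) r]
        label_dist_le_iff[OF t that(3,2) r] by (meson max.cobounded1 max.cobounded2 rtrancl_trans)
  qed
  moreover have "?d x y = 0 \<longleftrightarrow> x = y" if "x \<in> V" "y \<in> V" for x y
    using label_dist_pos[OF t that _ nd] by (auto simp: label_dist_def)
  moreover have "V \<noteq> {}"
    using t by (simp add: tree_def simple_graph_def)
  ultimately show ?thesis
    using nonneg unfolding ultrametric_on_def by blast
qed

text \<open>The threshold graph at \<open>r\<close> consists of the edges with
  \<open>w e \<le> r\<close>, so it changes only at values of \<open>w\<close>, and positive
  distances can occur only there. The diagonal contributes \<open>0\<close>.\<close>

lemma distance_set_label_dist:
  assumes t: "tree V E" and fin: "finite V" and nd: "nondegenerate E l"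
    and w: "\<And>u v. {u, v} \<in> E \<Longrightarrow> w {u, v} = max (l u) (l v)"
  shows "distance_set V (label_dist V E l) = insert 0 (w ` E)"
proof
  let ?d = "label_dist V E l"
  have sg: "simple_graph V E"
    using t by (simp add: tree_def)
  have w_le: "(\<forall>v\<in>e. l v \<le> r) \<longleftrightarrow> w e \<le> r" if e: "e \<in> E" for e r
  proof -
    obtain u v where uv: "e = {u, v}"
      using simple_graph_edgeE[OF sg e] by metis
    show ?thesis
      using w[of u v] e by (simp add: uv)
  qed
  show "insert 0 (w ` E) \<subseteq> distance_set V ?d"
  proof safe
    obtain x where "x \<in> V"
      using sg by (auto simp: simple_graph_def)
    then show "0 \<in> distance_set V ?d"
      unfolding distance_set_def by (force simp: label_dist_def)
  next
    fix e assume e: "e \<in> E"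
    obtain u v where uv: "e = {u, v}" "u \<in> V" "v \<in> V"
      using simple_graph_edgeE[OF sg e] by metis
    then have "w e = ?d u v"
      using label_dist_edge[OF t] w e by metis
    with uv show "w e \<in> distance_set V ?d"
      by (auto simp: distance_set_def)
  qed
  show "distance_set V ?d \<subseteq> insert 0 (w ` E)"
  proof
    fix s assume "s \<in> distance_set V ?d"
    then obtain x y where xy: "x \<in> V" "y \<in> V" "s = ?d x y"
      by (auto simp: distance_set_def)
    have s: "0 \<le> s"
      using label_dist_nonneg[OF t xy(1,2) nd] xy(3) by simp
    \<comment> \<open>Lowering the threshold \<open>s\<close> to the largest value of \<open>w\<close> below it loses no edges.\<close>
    let ?A = "{a \<in> insert 0 (w ` E). a \<le> s}"
    \<comment> \<open>Including \<open>0\<close> keeps the maximum defined and nonnegative even if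
      no edge has weight at most \<open>s\<close>.\<close>
    have A: "finite ?A" "0 \<in> ?A"
      using simple_graph_finite_edges[OF sg fin] s by auto
    then have Max: "Max ?A \<in> ?A" "0 \<le> Max ?A"
      using Max_in[of ?A] by (blast, simp)
    have "w e \<le> s \<longleftrightarrow> w e \<le> Max ?A" if "e \<in> E" for e
      using that A Max by (auto intro: Max_ge)
    then have "{e \<in> E. \<forall>v\<in>e. l v \<le> s} = {e \<in> E. \<forall>v\<in>e. l v \<le> Max ?A}"
      using w_le by blast
    then have "?d x y \<le> Max ?A"
      using label_dist_le_iff[OF t xy(1,2) s, of l] label_dist_le_iff[OF t xy(1,2) Max(2), of l] xy(3)
      by simp
    with Max(1) xy(3) have "s = Max ?A" by simp
    with Max(1) show "s \<in> insert 0 (w ` E)" by simp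
  qed
qed

theorem theorem3p8:
  fixes V :: "'a set" and E :: "'a set set"
    and l :: "'a \<Rightarrow> real" and w :: "'a set \<Rightarrow> real"
  assumes "tree V E" and "finite V" and "card V \<ge> 2"
    and "labeling V l" and "nondegenerate E l"
    and "\<And>u v. {u, v} \<in> E \<Longrightarrow> w {u, v} = max (l u) (l v)"
  shows "((V, label_dist V E l) \<in> GH \<longleftrightarrow> inj_on w E) \<and>
    (inj_on w E \<longleftrightarrow> card (distance_set V (label_dist V E l)) = card E + 1) \<and>
    (card (distance_set V (label_dist V E l)) = card E + 1 \<longleftrightarrow>
      2 * card (distance_set V (label_dist V E l)) = 2 + (\<Sum>v\<in>V. degree V E v))"
proof -
  have sg: "simple_graph V E"
    using assms(1) by (simp add: tree_def)
  have finE: "finite E"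
    using simple_graph_finite_edges[OF sg assms(2)] .
  \<comment> \<open>Ensures that inserting \<open>0\<close> adds exactly one element to the distance
    set.\<close>
  have "0 \<notin> w ` E"
  proof
    assume "0 \<in> w ` E"
    then obtain e where e: "e \<in> E" "w e = 0" by auto
    obtain u v where "e = {u, v}"
      using simple_graph_edgeE[OF sg e(1)] by metis
    with e assms(5,6) show False
      by (metis less_irrefl nondegenerate_def)
  qed
  then have D: "card (distance_set V (label_dist V E l)) = card (w ` E) + 1"
    using finE by (simp add: distance_set_label_dist[OF assms(1,2,5,6)])
  have inj: "inj_on w E \<longleftrightarrow> card (w ` E) = card E"
    using finE by (metis card_image eq_card_imp_inj_on)
  \<comment> \<open>The \<open>+ 1\<close> contributed by the distance \<open>0\<close> cancels
    against the one in \<open>card V = card E + 1\<close>.\<close>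
  have "(V, label_dist V E l) \<in> GH \<longleftrightarrow> card (w ` E) = card E"
    using assms(2) label_dist_ultrametric[OF assms(1,5)] D tree_card_vertices[OF assms(1,2)]
    by (simp add: GH_def)
  then show ?thesis
    using D inj sum_degree[OF sg assms(2)] by simp
qed

end
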